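(* The space $\mathbb{S}$ is a semidendrite.
   Context: The underlying axiom system is ZF (no form of the axiom of choice is assumed). A point $c$ of a topological space $X$ disconnects $X$ between points $a,b\in X$ if there exist disjoint open sets $U,V$ in $X$ such that $X\setminus\{c\}=U\cup V$, $a\in U$ and $b\in V$. A continuum is a compact connected (Hausdorff) space. $X$ is a semicontinuum if, for each pair $a,b$ of points of $X$, there is a continuum $C$ in $X$ (i.e. a subspace that is a continuum) such that $a,b\in C$. $X$ is a semidendrite if it is a semicontinuum such that, for each pair $a,b$ of distinct points of $X$, there exists a point $c\in X$ which disconnects $X$ between $a$ and $b$. The set $\mathbb{S}$ (symmetrized max-plus algebra). Let $\varepsilon=-\infty$, $\mathbb{R}_\varepsilon=\mathbb{R}\cup\{\varepsilon\}$, $e^{-\infty}=0$. On $\mathbb{R}_\varepsilon\times\mathbb{R}_\varepsilon$ put $(a,b)\bigtriangledown(c,d)$ iff $\max(a,d)=\max(b,c)$, and put $(a,b)\sim(c,d)$ iff $(a,b)\bigtriangledown(c,d)$ in case $a\neq b$ and $c\neq d$, and iff $(a,b)=(c,d)$ otherwise. Then $\mathbb{S}=(\mathbb{R}_\varepsilon\times\mathbb{R}_\varepsilon)/_\sim$. For $r\in\mathbb{R}_\varepsilon$, the elements $\oplus r$, $\ominus r$, $r^\bullet$ of $\mathbb{S}$ are the classes of $(r,\varepsilon)$, $(\varepsilon,r)$, $(r,r)$. Every element of $\mathbb{S}$ has one of these forms, and the representation is unique except that $\oplus\varepsilon=\ominus\varepsilon=\varepsilon^\bullet$. The canonical embedding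 $\Phi:\mathbb{S}\to\mathbb{C}$ is $\Phi(\oplus r)=\theta e^r$, $\Phi(\ominus r)=\theta^2e^r$, $\Phi(r^\bullet)=e^r$, where $\theta=\frac{-1+\sqrt3 i}{2}$. The topology of $\mathbb{S}$ is the smallest one making $\Phi$ continuous. *)

theory Defs
  imports "HOL-Analysis.Analysis"
begin

section \<open>Semidendrites\<close>

definition disconnects_between :: "'a topology \<Rightarrow> 'a \<Rightarrow> 'a \<Rightarrow> 'a \<Rightarrow> bool" where
  "disconnects_between X c a b \<longleftrightarrow>
     (\<exists>U V. openin X U \<and> openin X V \<and> disjnt U V \<and>
            topspace X - {c} = U \<union> V \<and> a \<in> U \<and> b \<in> V)"

definition continuum_space :: "'a topology \<Rightarrow> bool" where
  "continuum_space X \<longleftrightarrow> compact_space X \<and> connected_space X \<and> Hausdorff_space X"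

definition semicontinuum :: "'a topology \<Rightarrow> bool" where
  "semicontinuum X \<longleftrightarrow>
     (\<forall>a\<in>topspace X. \<forall>b\<in>topspace X.
        \<exists>C\<subseteq>topspace X. continuum_space (subtopology X C) \<and> a \<in> C \<and> b \<in> C)"

definition semidendrite :: "'a topology \<Rightarrow> bool" where
  "semidendrite X \<longleftrightarrow>
     semicontinuum X \<and>
     (\<forall>a\<in>topspace X. \<forall>b\<in>topspace X. a \<noteq> b \<longrightarrow>
        (\<exists>c\<in>topspace X. disconnects_between X c a b))"


section \<open>The symmetrized max-plus algebra\<close>

definition R_eps :: "ereal set" where
  "R_eps = {r. r \<noteq> \<infinity>}"

definition exp_eps :: "ereal \<Rightarrow> real" where
  "exp_eps r = (if r = -\<infinity> then 0 else exp (real_of_ereal r))"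

fun balances :: "ereal \<times> ereal \<Rightarrow> ereal \<times> ereal \<Rightarrow> bool" where
  "balances (a, b) (c, d) \<longleftrightarrow> max a d = max b c"

definition smp_rel :: "((ereal \<times> ereal) \<times> (ereal \<times> ereal)) set" where
  "smp_rel = {((a, b), (c, d)).
     (a, b) \<in> R_eps \<times> R_eps \<and> (c, d) \<in> R_eps \<times> R_eps \<and>
     (if a \<noteq> b \<and> c \<noteq> d then balances (a, b) (c, d) else (a, b) = (c, d))}"

definition smp :: "(ereal \<times> ereal) set set" where
  "smp = (R_eps \<times> R_eps) // smp_rel"

definition smp_plus :: "ereal \<Rightarrow> (ereal \<times> ereal) set" where
  "smp_plus r = smp_rel `` {(r, -\<infinity>)}"

definition smp_minus :: "ereal \<Rightarrow> (ereal \<times> ereal) set" where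
  "smp_minus r = smp_rel `` {(-\<infinity>, r)}"

definition smp_bullet :: "ereal \<Rightarrow> (ereal \<times> ereal) set" where
  "smp_bullet r = smp_rel `` {(r, r)}"

definition theta :: complex where
  "theta = (-1 + complex_of_real (sqrt 3) * \<i>) / 2"

text \<open>The lemmas \<open>smp_cases\<close> and \<open>smp_embed_simps\<close> below show that the
  description is unique for every element of \<^term>\<open>smp\<close>.\<close>

definition smp_embed :: "(ereal \<times> ereal) set \<Rightarrow> complex" where
  "smp_embed x = (THE z. \<exists>r\<in>R_eps.
      x = smp_plus r \<and> z = theta * of_real (exp_eps r) \<or>
      x = smp_minus r \<and> z = theta\<^sup>2 * of_real (exp_eps r) \<or>
      x = smp_bullet r \<and> z = of_real (exp_eps r))"

text \<open>The library's pullback topology is the coarsest one for which the map is continuous.\<close>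

definition smp_topology :: "(ereal \<times> ereal) set topology" where
  "smp_topology = pullback_topology smp smp_embed euclidean"

lemma topspace_smp_topology [simp]: "topspace smp_topology = smp"
  by (simp add: smp_topology_def topspace_pullback_topology)

lemma smp_rel_iff:
  "((a, b), (c, d)) \<in> smp_rel \<longleftrightarrow>
     a \<in> R_eps \<and> b \<in> R_eps \<and> c \<in> R_eps \<and> d \<in> R_eps \<and>
     (a = c \<and> b = d \<or> a > b \<and> c > d \<and> a = c \<or> a < b \<and> c < d \<and> b = d)"
  unfolding smp_rel_def by (auto simp: max_def split: if_splits)

lemma equiv_smp_rel: "equiv (R_eps \<times> R_eps) smp_rel"
  by (rule equivI)
     (auto simp: refl_on_def smp_rel_iff intro!: symI transI)

lemma R_eps_MInfty [simp]: "-\<infinity> \<in> R_eps"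
  by (simp add: R_eps_def)

lemma smp_class_eq_iff:
  assumes "p \<in> R_eps \<times> R_eps" "q \<in> R_eps \<times> R_eps"
  shows "smp_rel `` {p} = smp_rel `` {q} \<longleftrightarrow> (p, q) \<in> smp_rel"
  using eq_equiv_class_iff[OF equiv_smp_rel] assms by blast

lemma smp_eq_iffs:
  assumes "r \<in> R_eps" "s \<in> R_eps"
  shows "smp_plus r = smp_plus s \<longleftrightarrow> r = s"
    and "smp_minus r = smp_minus s \<longleftrightarrow> r = s"
    and "smp_bullet r = smp_bullet s \<longleftrightarrow> r = s"
    and "smp_plus r = smp_minus s \<longleftrightarrow> r = -\<infinity> \<and> s = -\<infinity>"
    and "smp_plus r = smp_bullet s \<longleftrightarrow> r = -\<infinity> \<and> s = -\<infinity>"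
    and "smp_minus r = smp_bullet s \<longleftrightarrow> r = -\<infinity> \<and> s = -\<infinity>"
  using assms
  by (auto simp: smp_plus_def smp_minus_def smp_bullet_def smp_class_eq_iff smp_rel_iff)

lemma smp_cases:
  assumes "x \<in> smp"
  obtains r where "r \<in> R_eps" "x = smp_plus r"
    | r where "r \<in> R_eps" "x = smp_minus r"
    | r where "r \<in> R_eps" "x = smp_bullet r"
proof -
  obtain a b where ab: "a \<in> R_eps" "b \<in> R_eps" "x = smp_rel `` {(a, b)}"
    using assms unfolding smp_def by (auto elim!: quotientE)
  consider "a > b" | "a < b" | "a = b" by fastforce
  then show thesis
  proof cases
    case 1
    then have "x = smp_plus a"
      using ab by (auto simp: smp_plus_def smp_class_eq_iff smp_rel_iff intro: le_less_trans)
    with ab that show thesis by blast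
  next
    case 2
    then have "x = smp_minus b"
      using ab by (auto simp: smp_minus_def smp_class_eq_iff smp_rel_iff intro: le_less_trans)
    with ab that show thesis by blast
  next
    case 3
    with ab that show thesis by (auto simp: smp_bullet_def)
  qed
qed

lemma smp_embed_simps:
  assumes "r \<in> R_eps"
  shows "smp_embed (smp_plus r) = theta * of_real (exp_eps r)"
    and "smp_embed (smp_minus r) = theta\<^sup>2 * of_real (exp_eps r)"
    and "smp_embed (smp_bullet r) = of_real (exp_eps r)"
  unfolding smp_embed_def using assms
  by (intro the_equality; auto simp: smp_eq_iffs eq_commute[of "smp_minus _" "smp_plus _"]
      eq_commute[of "smp_bullet _" "smp_plus _"] eq_commute[of "smp_bullet _" "smp_minus _"] exp_eps_def)+

lemma smp_forms_in_smp:
  assumes "r \<in> R_eps"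
  shows "smp_plus r \<in> smp" "smp_minus r \<in> smp" "smp_bullet r \<in> smp"
  using assms by (auto simp: smp_plus_def smp_minus_def smp_bullet_def smp_def intro: quotientI)

end

theory Submission
  imports Defs
begin

text \<open>
  The embedding is injective and its image \<open>T\<close> consists of the three closed rays from the
  origin through the cube roots of unity; since the space carries the pullback topology, it is
  homeomorphic to \<open>T\<close> (\<open>homeomorphic_map_pullback_topology\<close>), and being a semidendrite is a
  homeomorphism invariant (\<open>homeomorphic_space_semidendrite\<close>). It remains to see that \<open>T\<close> is a
  semidendrite, where the only geometric fact needed is that distinct cube roots of unity
  enclose an obtuse angle (their inner product is \<open>-1/2\<close>).

  Two points \<open>a, b\<close> of \<open>T\<close> lie in the continuum formed by the segments from \<open>0\<close> to \<open>a\<close> and to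
  \<open>b\<close>. For the separation of points, let \<open>v\<close> be the direction of a ray and consider the
  functional \<open>z \<mapsto> v \<bullet> z\<close>. On the ray of \<open>v\<close> it is the distance from the origin,
  and on every other ray it is negative away from the origin. So for \<open>m \<ge> 0\<close> the level \<open>m\<close>
  is attained on \<open>T\<close> only at \<open>m v\<close>, and this point disconnects \<open>T\<close> into the parts below and
  above that level (\<open>disconnects_between_rays\<close>). Given two distinct points, take \<open>v\<close> to be the
  direction of the one farther from the origin: it has the larger value of the functional,
  and some \<open>m \<ge> 0\<close> fits strictly in between (\<open>semidendrite_obtuse_rays\<close>). The argument
  works for any family of pairwise obtuse rays in a real inner product space.
\<close>

section \<open>Homeomorphism invariance\<close>

lemma homeomorphic_continuum_space:
  assumes "X homeomorphic_space Y"
  shows "continuum_space X \<longleftrightarrow> continuum_space Y"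
  unfolding continuum_space_def
  using homeomorphic_compact_space[OF assms] homeomorphic_connected_space[OF assms]
    homeomorphic_Hausdorff_space[OF assms] by simp

lemma homeomorphic_map_disconnects_between:
  assumes f: "homeomorphic_map X Y f" and c: "c \<in> topspace X"
    and "disconnects_between X c a b"
  shows "disconnects_between Y (f c) (f a) (f b)"
proof -
  obtain U V where UV: "openin X U" "openin X V" "disjnt U V"
    "topspace X - {c} = U \<union> V" "a \<in> U" "b \<in> V"
    using assms(3) unfolding disconnects_between_def by blast
  have sub: "U \<subseteq> topspace X" "V \<subseteq> topspace X"
    using UV openin_subset by auto
  have inj: "inj_on f (topspace X)"
    using f homeomorphic_imp_injective_map by blast
  have "openin Y (f ` U)" "openin Y (f ` V)"
    using homeomorphic_map_openness[OF f] UV sub by auto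
  moreover have "disjnt (f ` U) (f ` V)"
    using inj UV(3) sub unfolding disjnt_def inj_on_def by blast
  moreover have "topspace Y - {f c} = f ` (topspace X - {c})"
    using inj_on_image_set_diff[OF inj, of "topspace X" "{c}"] c
      homeomorphic_imp_surjective_map[OF f] by auto
  ultimately show ?thesis
    unfolding disconnects_between_def using UV by (metis image_Un imageI)
qed

proposition homeomorphic_space_semidendrite:
  assumes "X homeomorphic_space Y" "semidendrite X"
  shows "semidendrite Y"
proof -
  obtain f where f: "homeomorphic_map X Y f"
    using assms(1) homeomorphic_space by blast
  have onto: "topspace Y = f ` topspace X"
    using homeomorphic_imp_surjective_map[OF f] by auto
  have "\<exists>C\<subseteq>topspace Y. continuum_space (subtopology Y C) \<and> f a \<in> C \<and> f b \<in> C"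
    if ab: "a \<in> topspace X" "b \<in> topspace X" for a b
  proof -
    obtain C where C: "C \<subseteq> topspace X" "continuum_space (subtopology X C)" "a \<in> C" "b \<in> C"
      using assms(2) ab unfolding semidendrite_def semicontinuum_def by meson
    have "homeomorphic_map (subtopology X C) (subtopology Y (f ` C)) f"
      using f C(1) onto homeomorphic_imp_injective_map[OF f]
      by (intro homeomorphic_map_subtopologies_alt) (auto simp: inj_on_def)
    then have "continuum_space (subtopology Y (f ` C))"
      using homeomorphic_continuum_space homeomorphic_map_imp_homeomorphic_space C(2) by metis
    with C onto show ?thesis
      by (intro exI[of _ "f ` C"]) auto
  qed
  moreover have "\<exists>c\<in>topspace Y. disconnects_between Y c (f a) (f b)"
    if ab: "a \<in> topspace X" "b \<in> topspace X" "f a \<noteq> f b" for a b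
    using assms(2) ab onto homeomorphic_map_disconnects_between[OF f]
    unfolding semidendrite_def by (metis imageI)
  ultimately show ?thesis
    unfolding semidendrite_def semicontinuum_def onto by blast
qed

text \<open>Every open set of the pullback topology is \<open>f -` W \<inter> S\<close> for some open \<open>W\<close>, and its image
  is \<open>W \<inter> f ` S\<close>; so \<open>f\<close> is open onto its image.\<close>

lemma homeomorphic_map_pullback_topology:
  assumes "inj_on f S"
  shows "homeomorphic_map (pullback_topology S f T) (subtopology T (f ` S)) f"
proof -
  have top: "topspace (pullback_topology S f T) = S \<inter> f -` topspace T"
    by (auto simp: topspace_pullback_topology)
  have "continuous_map (pullback_topology S f T) T (id \<circ> f)"
    by (intro continuous_map_pullback continuous_map_id)
  then have cont: "continuous_map (pullback_topology S f T) (subtopology T (f ` S)) f"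
    using top by (auto simp: continuous_map_in_subtopology)
  have "openin (subtopology T (f ` S)) (f ` U)" if U: "openin (pullback_topology S f T) U" for U
  proof -
    obtain W where W: "openin T W" "U = f -` W \<inter> S"
      using U unfolding openin_pullback_topology by blast
    then have "f ` U = W \<inter> f ` S" by blast
    then show ?thesis
      using W unfolding openin_subtopology by blast
  qed
  moreover have "inj_on f (S \<inter> f -` topspace T)"
    using assms by (rule inj_on_subset) blast
  moreover have "f ` (S \<inter> f -` topspace T) = topspace (subtopology T (f ` S))"
    by auto
  ultimately show ?thesis
    by (intro bijective_open_imp_homeomorphic_map cont) (simp_all add: open_map_def top)
qed

section \<open>Unions of rays\<close>

definition rays_from_origin :: "'a::real_vector set \<Rightarrow> 'a set" where
  "rays_from_origin R = {t *\<^sub>R u | t u. 0 \<le> t \<and> u \<in> R}"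

lemma closed_segment_subset_rays:
  assumes "z \<in> rays_from_origin R"
  shows "closed_segment 0 z \<subseteq> rays_from_origin R"
proof
  fix w assume "w \<in> closed_segment 0 z"
  then obtain k where "0 \<le> k" "w = k *\<^sub>R z"
    by (auto simp: in_segment)
  moreover obtain t u where "z = t *\<^sub>R u" "0 \<le> t" "u \<in> R"
    using assms unfolding rays_from_origin_def by blast
  ultimately show "w \<in> rays_from_origin R"
    unfolding rays_from_origin_def
    by (intro CollectI exI[of _ "k * t"] exI[of _ u]) auto
qed

text \<open>The two segments joining the given points to the origin meet there, so their union is
  connected, and it is compact even when there are infinitely many rays.\<close>

lemma semicontinuum_rays:
  fixes R :: "'a::real_normed_vector set"
  shows "semicontinuum (top_of_set (rays_from_origin R))"
  unfolding semicontinuum_def topspace_euclidean_subtopology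
proof (intro ballI)
  fix a b assume ab: "a \<in> rays_from_origin R" "b \<in> rays_from_origin R"
  define C where "C = closed_segment 0 a \<union> closed_segment 0 b"
  have sub: "C \<subseteq> rays_from_origin R"
    unfolding C_def using ab closed_segment_subset_rays by blast
  have "compact C" "connected C"
    unfolding C_def by (auto intro!: compact_Un connected_Un)
  then have "continuum_space (top_of_set C)"
    unfolding continuum_space_def
    by (simp add: compact_space_subtopology Hausdorff_space_subtopology
        connected_space_subtopology Hausdorff_space_euclidean)
  moreover have "subtopology (top_of_set (rays_from_origin R)) C = top_of_set C"
    using sub by (simp add: subtopology_subtopology Int_absorb1)
  ultimately show "\<exists>C\<subseteq>rays_from_origin R.
      continuum_space (subtopology (top_of_set (rays_from_origin R)) C) \<and> a \<in> C \<and> b \<in> C"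
    using sub by (intro exI[of _ C]) (auto simp: C_def)
qed

text \<open>The hyperplane \<open>{z. v \<bullet> z = m}\<close> with \<open>m \<ge> 0\<close> meets the union of the rays only in
  \<open>m v\<close>, because on rays other than that of \<open>v\<close> the functional takes no positive value and
  vanishes only at the origin. The two open half-spaces then give the separation.\<close>

lemma disconnects_between_rays:
  fixes R :: "'a::real_inner set"
  assumes unit: "\<And>u. u \<in> R \<Longrightarrow> norm u = 1"
    and obtuse: "\<And>u w. u \<in> R \<Longrightarrow> w \<in> R \<Longrightarrow> u \<noteq> w \<Longrightarrow> u \<bullet> w < 0"
    and v: "v \<in> R" and m: "0 \<le> m"
    and p: "p \<in> rays_from_origin R" "v \<bullet> p < m"
    and q: "q \<in> rays_from_origin R" "m < v \<bullet> q"
  shows "disconnects_between (top_of_set (rays_from_origin R)) (m *\<^sub>R v) p q"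
proof -
  let ?T = "rays_from_origin R"
  have vv: "v \<bullet> v = 1"
    using unit[OF v] by (simp add: dot_square_norm)
  have level: "z = m *\<^sub>R v" if z: "z \<in> ?T" "v \<bullet> z = m" for z
  proof -
    obtain t u where tu: "z = t *\<^sub>R u" "0 \<le> t" "u \<in> R"
      using z unfolding rays_from_origin_def by blast
    show ?thesis
    proof (cases "u = v")
      case True
      then show ?thesis using tu z vv by simp
    next
      case False
      then have "v \<bullet> u < 0" using obtuse tu v by auto
      moreover have "0 \<le> t * (v \<bullet> u)" using z tu m by simp
      ultimately have "t = 0"
        using tu(2) by (simp add: zero_le_mult_iff)
      then show ?thesis using tu z by simp
    qed
  qed
  have "openin (top_of_set ?T) {z \<in> ?T. v \<bullet> z < m}"
    using open_halfspace_lt[of v m] by (auto simp: openin_open)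
  moreover have "openin (top_of_set ?T) {z \<in> ?T. m < v \<bullet> z}"
    using open_halfspace_gt[of m v] by (auto simp: openin_open)
  moreover have "?T - {m *\<^sub>R v} = {z \<in> ?T. v \<bullet> z < m} \<union> {z \<in> ?T. m < v \<bullet> z}"
  proof (intro subset_antisym subsetI)
    fix z assume "z \<in> ?T - {m *\<^sub>R v}"
    then show "z \<in> {z \<in> ?T. v \<bullet> z < m} \<union> {z \<in> ?T. m < v \<bullet> z}"
      using level[of z] by (cases "v \<bullet> z" m rule: linorder_cases) auto
  next
    fix z assume "z \<in> {z \<in> ?T. v \<bullet> z < m} \<union> {z \<in> ?T. m < v \<bullet> z}"
    then show "z \<in> ?T - {m *\<^sub>R v}"
      using vv by auto
  qed
  moreover have "disjnt {z \<in> ?T. v \<bullet> z < m} {z \<in> ?T. m < v \<bullet> z}"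
    unfolding disjnt_iff by fastforce
  ultimately show ?thesis
    unfolding disconnects_between_def topspace_euclidean_subtopology
    using p q by blast
qed

lemma disconnects_between_commute:
  "disconnects_between X c a b \<longleftrightarrow> disconnects_between X c b a"
  unfolding disconnects_between_def by (metis disjnt_sym sup_commute)

text \<open>Let \<open>q = t v\<close> be at least as far from the origin as \<open>p\<close>. Then \<open>v \<bullet> p < t = v \<bullet> q\<close>: on a
  common ray \<open>p\<close> is strictly closer to the origin, and otherwise \<open>v \<bullet> p \<le> 0\<close>.
  Hence a level set of the functional separates \<open>p\<close> from \<open>q\<close>.\<close>

proposition semidendrite_obtuse_rays:
  fixes R :: "'a::real_inner set"
  assumes unit: "\<And>u. u \<in> R \<Longrightarrow> norm u = 1"
    and obtuse: "\<And>u w. u \<in> R \<Longrightarrow> w \<in> R \<Longrightarrow> u \<noteq> w \<Longrightarrow> u \<bullet> w < 0"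
  shows "semidendrite (top_of_set (rays_from_origin R))"
proof -
  let ?T = "rays_from_origin R"
  have separated: "\<exists>c\<in>?T. disconnects_between (top_of_set ?T) c p q"
    if pq: "p \<in> ?T" "q \<in> ?T" "p \<noteq> q" "norm p \<le> norm q" for p q
  proof -
    obtain t v where tv: "q = t *\<^sub>R v" "0 \<le> t" "v \<in> R"
      using pq unfolding rays_from_origin_def by blast
    obtain s u where su: "p = s *\<^sub>R u" "0 \<le> s" "u \<in> R"
      using pq unfolding rays_from_origin_def by blast
    have "s \<le> t" using pq(4) tv su unit by simp
    have "0 < t" using tv su \<open>s \<le> t\<close> pq(3) by (cases "t = 0") auto
    have q: "v \<bullet> q = t" using tv unit by (simp add: dot_square_norm)
    have p: "v \<bullet> p < t"
    proof (cases "u = v")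
      case True
      then show ?thesis using su tv unit \<open>s \<le> t\<close> pq(3) by (auto simp: dot_square_norm)
    next
      case False
      then have "s * (v \<bullet> u) \<le> 0"
        using obtuse su tv by (intro mult_nonneg_nonpos) (auto intro: less_imp_le)
      then show ?thesis using su \<open>0 < t\<close> by simp
    qed
    \<comment> \<open>The midpoint of the two values may be negative, and a negative level may cut several rays;
      it is then replaced by level \<open>0\<close>, that is, the cut is made at the origin.\<close>
    define m where "m = max 0 ((v \<bullet> p + t) / 2)"
    have "v \<bullet> p < (v \<bullet> p + t) / 2" "(v \<bullet> p + t) / 2 < t"
      using p by simp_all
    then have "0 \<le> m" "v \<bullet> p < m" "m < v \<bullet> q"
      unfolding m_def q using \<open>0 < t\<close> by (simp_all add: less_max_iff_disj)
    then have "disconnects_between (top_of_set ?T) (m *\<^sub>R v) p q"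
      using disconnects_between_rays[OF unit obtuse] tv pq by blast
    moreover have "m *\<^sub>R v \<in> ?T"
      using tv \<open>0 \<le> m\<close> unfolding rays_from_origin_def by blast
    ultimately show ?thesis by blast
  qed
  have "\<exists>c\<in>?T. disconnects_between (top_of_set ?T) c p q"
    if "p \<in> ?T" "q \<in> ?T" "p \<noteq> q" for p q
  proof (cases "norm p \<le> norm q")
    case True
    then show ?thesis using separated that by blast
  next
    case False
    then have "\<exists>c\<in>?T. disconnects_between (top_of_set ?T) c q p"
      using separated[of q p] that by simp
    then show ?thesis using disconnects_between_commute by metis
  qed
  then show ?thesis
    unfolding semidendrite_def using semicontinuum_rays by auto
qed

section \<open>The image of the canonical embedding\<close>

lemma theta_components:
  "Re theta = - 1 / 2" "Im theta = sqrt 3 / 2"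
  "Re (theta\<^sup>2) = - 1 / 2" "Im (theta\<^sup>2) = - sqrt 3 / 2"
  by (auto simp: theta_def power2_eq_square field_simps)

lemma cube_roots_unit:
  assumes "u \<in> {1, theta, theta\<^sup>2}"
  shows "norm u = 1"
  using assms by (auto simp: cmod_def theta_components power_divide simp del: Re_power2 Im_power2)

lemma cube_roots_obtuse:
  assumes "u \<in> {1, theta, theta\<^sup>2}" "w \<in> {1, theta, theta\<^sup>2}" "u \<noteq> w"
  shows "u \<bullet> w < 0"
  using assms by (auto simp: inner_complex_def theta_components)

lemma exp_eps_eq_iff:
  assumes "r \<in> R_eps" "s \<in> R_eps"
  shows "exp_eps r = exp_eps s \<longleftrightarrow> r = s"
  using assms by (cases r; cases s) (auto simp: exp_eps_def R_eps_def)

lemma exp_eps_eq_0_iff: "exp_eps r = 0 \<longleftrightarrow> r = -\<infinity>"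
  by (auto simp: exp_eps_def)

lemma exp_eps_nonneg: "0 \<le> exp_eps r"
  by (simp add: exp_eps_def)

lemma exp_eps_surj:
  assumes "0 \<le> t"
  obtains r where "r \<in> R_eps" "exp_eps r = t"
proof (cases "t = 0")
  case True
  then show ?thesis using that[of "-\<infinity>"] by (simp add: exp_eps_def)
next
  case False
  then show ?thesis using that[of "ereal (ln t)"] assms by (simp add: exp_eps_def R_eps_def)
qed

text \<open>A point other than the origin determines its ray and its modulus, and the modulus
  determines \<open>r\<close>. At the origin \<open>r = -\<infinity>\<close>, and there the three forms coincide.\<close>

lemma inj_on_smp_embed: "inj_on smp_embed smp"
proof (rule inj_onI)
  fix x y assume xy: "x \<in> smp" "y \<in> smp" "smp_embed x = smp_embed y"
  have zero: "exp_eps (-\<infinity>) = 0" "0 = exp_eps r \<longleftrightarrow> r = -\<infinity>" for r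
    by (auto simp: exp_eps_def)
  \<comment> \<open>Points of different forms agree in real and imaginary part only if both moduli vanish.\<close>
  show "x = y"
    by (rule smp_cases[OF xy(1)]; rule smp_cases[OF xy(2)];
        use xy(3) exp_eps_nonneg in \<open>auto simp: smp_embed_simps smp_eq_iffs complex_eq_iff theta_components
          exp_eps_eq_iff exp_eps_eq_0_iff zero eq_commute[of "smp_minus _" "smp_plus _"]
          eq_commute[of "smp_bullet _" "smp_plus _"] eq_commute[of "smp_bullet _" "smp_minus _"]\<close>)
qed

lemma smp_embed_image:
  "smp_embed ` smp = rays_from_origin {1, theta, theta\<^sup>2}"
proof (intro subset_antisym subsetI)
  fix z assume "z \<in> smp_embed ` smp"
  then obtain x where x: "x \<in> smp" "z = smp_embed x" by blast
  show "z \<in> rays_from_origin {1, theta, theta\<^sup>2}"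
    using x(1)
    by (cases rule: smp_cases)
       (use x(2) exp_eps_nonneg in \<open>force simp: smp_embed_simps rays_from_origin_def
          scaleR_conv_of_real mult.commute\<close>)+
next
  fix z assume "z \<in> rays_from_origin {1, theta, theta\<^sup>2}"
  then obtain t u where tu: "z = t *\<^sub>R u" "0 \<le> t" "u \<in> {1, theta, theta\<^sup>2}"
    unfolding rays_from_origin_def by blast
  obtain r where "r \<in> R_eps" "exp_eps r = t" using exp_eps_surj tu by blast
  then have "smp_embed (smp_bullet r) = t *\<^sub>R 1" "smp_embed (smp_plus r) = t *\<^sub>R theta"
    "smp_embed (smp_minus r) = t *\<^sub>R theta\<^sup>2"
    by (simp_all add: smp_embed_simps scaleR_conv_of_real mult.commute)
  with tu \<open>r \<in> R_eps\<close> show "z \<in> smp_embed ` smp"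
    using smp_forms_in_smp[of r] by (auto intro: rev_image_eqI)
qed

theorem proposition34: "semidendrite smp_topology"
proof -
  have "homeomorphic_map smp_topology (top_of_set (rays_from_origin {1, theta, theta\<^sup>2})) smp_embed"
    using homeomorphic_map_pullback_topology[OF inj_on_smp_embed, of euclidean]
    by (simp add: smp_topology_def smp_embed_image)
  moreover have "semidendrite (top_of_set (rays_from_origin {1, theta, theta\<^sup>2}))"
    by (rule semidendrite_obtuse_rays) (use cube_roots_unit cube_roots_obtuse in blast)+
  ultimately show ?thesis
    using homeomorphic_space_semidendrite homeomorphic_map_imp_homeomorphic_space
      homeomorphic_space_sym by meson
qed

end
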